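(* Let $f\in L^\infty(\mathbb{R}_+)$, let $z_p:(-\infty,0)\to\mathbb{R}$ be Lipschitz continuous, and let $\varrho:\mathbb{R}_+\to\mathbb{R}_+$ be a Lipschitz continuous function such that $\int_0^\infty \varrho(a)\,da=1$, $\int_0^\infty (1+a)^2\varrho(a)\,da<\infty$, $\partial_a\varrho(a)\le 0$, and such that there is a constant $\zeta>0$ with $-\partial_a\varrho(a)/\varrho(a)\le\zeta$ for all $a>0$. Let $T>0$. For every step $h>0$ such that $N:=T/h\in\mathbb{N}$, set $R_j:=\frac1h\int_{jh}^{(j+1)h}\varrho(a)\,da$ for $j\ge0$, $f^n:=\frac1h\int_{nh}^{(n+1)h}f(t)\,dt$ for $n\geq 0$, $Z_p^n:=\frac1h\int_{nh}^{(n+1)h}z_p(t)\,dt$ for $n<0$, and let $(Z^n)_{n\le N}$ be the solution of $$Z^n-h\sum_{j\ge0}Z^{n-j}R_j=f^n\quad (n\in\{0,\dots,N\}),\qquad Z^n=Z_p^n\quad (n<0).$$ Then $(Z^n)_{n\in\{0,\dots,N\}}$ is bounded uniformly with respect to $h$: there is a constant $C>0$, independent of $h$, such that $|Z^n|\le C$ for all $n\in\{0,\dots,N\}$ and all such $h$.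
   Context: $\mathbb{R}_+=[0,\infty)$. The derivative $\partial_a\varrho$ of the Lipschitz function $\varrho$ exists almost everywhere, and pointwise conditions on it are understood for almost every $a$. The condition $-\partial_a\varrho/\varrho\le\zeta$ presupposes $\varrho>0$. *)

theory Defs
  imports "HOL-Analysis.Analysis"
begin

definition L_infinity_on :: "real set \<Rightarrow> (real \<Rightarrow> real) set" where
  "L_infinity_on S =
     {f. f \<in> borel_measurable (lebesgue_on S) \<and>
         (\<exists>K. AE t in lebesgue_on S. \<bar>f t\<bar> \<le> K)}"

text \<open>
  The same averaging operator gives \<open>R\<^sub>j\<close>, \<open>f\<^sup>n\<close> and \<open>Z\<^sub>p\<^sup>n\<close>. For \<open>n = -1\<close> the closed cell \<open>[-h, 0]\<close>
  contains the point \<open>0\<close>, where the past datum is not prescribed; it is a null set.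
\<close>

definition cell_mean :: "real \<Rightarrow> (real \<Rightarrow> real) \<Rightarrow> int \<Rightarrow> real" where
  "cell_mean h g n =
     (1 / h) * (LINT t:{of_int n * h..(of_int n + 1) * h}|lebesgue. g t)"

text \<open>
  A sequence indexed by all integers \<open>n \<le> N\<close> is a function on \<open>int\<close> whose
  values beyond \<open>N\<close> are irrelevant. Convergence of the series is not a separate
  requirement: under a Lipschitz past \<open>zp\<close> and a kernel with finite first moment
  it holds for every \<open>Z\<close> agreeing with the cell means of \<open>zp\<close> on negative indices.
\<close>

definition discrete_solution ::
  "real \<Rightarrow> nat \<Rightarrow> (real \<Rightarrow> real) \<Rightarrow> (real \<Rightarrow> real) \<Rightarrow> (real \<Rightarrow> real) \<Rightarrow> (int \<Rightarrow> real) \<Rightarrow> bool" where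
  "discrete_solution h N \<rho> f zp Z \<longleftrightarrow>
     (\<forall>n\<in>{0..int N}.
        Z n - h * (\<Sum>j. Z (n - int j) * cell_mean h \<rho> (int j)) = cell_mean h f n) \<and>
     (\<forall>n<0. Z n = cell_mean h zp n)"

end

theory Submission
  imports Defs
begin

text \<open>
  Since the weights \<open>p\<^sub>j = h R\<^sub>j\<close> are the \<open>\<rho>\<close>-masses of the cells and \<open>h \<le> T\<close>, the implicit weight
  satisfies \<open>p\<^sub>0 \<le> q\<close>, where \<open>q\<close> is the mass of \<open>[0, T]\<close>. As \<open>\<rho>\<close> is positive, \<open>q < 1\<close>, so the
  implicit term can be absorbed on the left without any smallness of \<open>h\<close>. The terms with
  \<open>j > n\<close> involve only the past, which grows at most linearly, and are controlled by the moment
  of \<open>\<rho>\<close>; the remaining weights are \<open>O(h)\<close> because \<open>\<rho>\<close> is bounded on \<open>[0, 2T]\<close>. A discrete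
  Gronwall argument over \<open>n h \<le> T\<close> concludes.
\<close>

section \<open>Set integrals over intervals and bounds on cell means\<close>

lemma set_integrable_const_Icc:
  fixes c :: real
  shows "set_integrable lebesgue {a..b::real} (\<lambda>t. c)"
  by (simp add: set_integrable_def lmeasurable_iff_integrable[symmetric])

lemma abs_set_lebesgue_integral_le:
  fixes g :: "real \<Rightarrow> real"
  assumes "a \<le> b" "0 \<le> K" and bound: "AE t in lebesgue. t \<in> {a..b} \<longrightarrow> \<bar>g t\<bar> \<le> K"
  shows "\<bar>LINT t:{a..b}|lebesgue. g t\<bar> \<le> K * (b - a)"
proof (cases "set_integrable lebesgue {a..b} g")
  case True
  have "\<bar>LINT t:{a..b}|lebesgue. g t\<bar> \<le> (LINT t:{a..b}|lebesgue. \<bar>g t\<bar>)"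
    using set_integral_norm_bound[OF True] by simp
  also have "\<dots> \<le> (LINT t:{a..b}|lebesgue. K)"
  proof (rule set_integral_mono_AE)
    show "set_integrable lebesgue {a..b} (\<lambda>t. \<bar>g t\<bar>)"
      using True by (rule set_integrable_abs)
    show "set_integrable lebesgue {a..b} (\<lambda>t. K)"
      by (rule set_integrable_const_Icc)
    show "AE t\<in>{a..b} in lebesgue. \<bar>g t\<bar> \<le> K"
      using bound by simp
  qed
  also have "\<dots> = K * (b - a)"
    using assms(1) by (simp add: set_lebesgue_integral_def)
  finally show ?thesis .
next
  \<comment> \<open>A non-integrable integrand has integral 0 by convention, and
    \<open>0 \<le> K * (b - a)\<close>.\<close>
  case False
  then show ?thesis
    using assms by (simp add: set_lebesgue_integral_def set_integrable_def not_integrable_integral_eq)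
qed

lemma abs_cell_mean_le:
  assumes "0 < h" "0 \<le> K"
    and "AE t in lebesgue. t \<in> {of_int n * h..(of_int n + 1) * h} \<longrightarrow> \<bar>g t\<bar> \<le> K"
  shows "\<bar>cell_mean h g n\<bar> \<le> K"
proof -
  have "\<bar>LINT t:{of_int n * h..(of_int n + 1) * h}|lebesgue. g t\<bar>
      \<le> K * ((of_int n + 1) * h - of_int n * h)"
    using assms by (intro abs_set_lebesgue_integral_le) (auto simp: algebra_simps)
  also have "\<dots> = K * h" by (simp add: algebra_simps)
  finally show ?thesis
    using assms(1) by (simp add: cell_mean_def abs_mult field_simps)
qed

text \<open>The closed intervals share only the point \<open>b\<close>, a null set, so additivity
  over almost disjoint sets applies. This lets closed cells be chained.\<close>

lemma set_lebesgue_integral_combine: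
  fixes g :: "real \<Rightarrow> real"
  assumes "a \<le> b" "b \<le> c" "set_integrable lebesgue {a..c} g"
  shows "(LINT t:{a..c}|lebesgue. g t)
    = (LINT t:{a..b}|lebesgue. g t) + (LINT t:{b..c}|lebesgue. g t)"
proof -
  have "AE t in lebesgue. t \<noteq> b"
    by (rule AE_completion) (rule AE_lborel_singleton)
  then have "AE t in lebesgue. \<not> (t \<in> {a..b} \<and> t \<in> {b..c})"
    by eventually_elim auto
  moreover have "{a..c} = {a..b} \<union> {b..c}" using assms by auto
  ultimately show ?thesis
    using assms by (auto intro!: set_integral_Un_AE intro: set_integrable_subset)
qed

lemma set_lebesgue_integral_mono_set:
  fixes g :: "real \<Rightarrow> real"
  assumes "set_integrable lebesgue B g" "A \<subseteq> B" "A \<in> sets lebesgue" "\<And>t. t \<in> B \<Longrightarrow> 0 \<le> g t"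
  shows "(LINT t:A|lebesgue. g t) \<le> (LINT t:B|lebesgue. g t)"
  unfolding set_lebesgue_integral_def
proof (rule integral_mono)
  show "integrable lebesgue (\<lambda>t. indicator A t *\<^sub>R g t)"
    using set_integrable_subset[OF assms(1,3,2)] by (simp add: set_integrable_def)
qed (use assms in \<open>auto simp: set_integrable_def indicator_def\<close>)

lemma cell_subset:
  assumes "0 < (h::real)"
  shows "{of_int (int j) * h..(of_int (int j) + 1) * h} \<subseteq> {0..}"
proof -
  have "0 \<le> real j * h" using assms by simp
  then show ?thesis by auto
qed

section \<open>Series of cell means of a nonnegative integrable function\<close>

context
  fixes h :: real and g :: "real \<Rightarrow> real"
  assumes h_pos: "0 < h" and g_int: "set_integrable lebesgue {0..} g"
    and g_nonneg: "\<And>t. 0 \<le> t \<Longrightarrow> 0 \<le> g t"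
begin

lemma set_integrable_Icc: "0 \<le> a \<Longrightarrow> set_integrable lebesgue {a..b} g"
  by (rule set_integrable_subset[OF g_int]) auto

lemma cell_mean_nonneg: "0 \<le> cell_mean h g (int j)"
proof -
  have "0 \<le> indicator {of_int (int j) * h..(of_int (int j) + 1) * h} t *\<^sub>R g t" for t
    using g_nonneg[of t] cell_subset[OF h_pos, of j] by (auto simp: indicator_def)
  then show ?thesis
    unfolding cell_mean_def set_lebesgue_integral_def using h_pos
    by (intro mult_nonneg_nonneg Bochner_Integration.integral_nonneg) auto
qed

lemma sum_cell_mean:
  "(\<Sum>j<n. cell_mean h g (int j)) = (LINT t:{0..real n * h}|lebesgue. g t) / h"
proof (induction n)
  case 0
  \<comment> \<open>With no cells the interval degenerates to a point; the constant bound
    \<open>\<bar>g 0\<bar>\<close> times length 0 gives 0.\<close>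
  have "(LINT t:{0::real}|lebesgue. g t) = 0"
    using abs_set_lebesgue_integral_le[of 0 0 "\<bar>g 0\<bar>" g] by simp
  then show ?case by simp
next
  case (Suc n)
  have "(LINT t:{0..real (Suc n) * h}|lebesgue. g t)
      = (LINT t:{0..real n * h}|lebesgue. g t)
        + (LINT t:{real n * h..real (Suc n) * h}|lebesgue. g t)"
    using h_pos by (intro set_lebesgue_integral_combine set_integrable_Icc) auto
  then show ?case
    using Suc by (simp add: cell_mean_def add_divide_distrib add.commute)
qed

lemma sum_cell_mean_le: "(\<Sum>j<n. cell_mean h g (int j)) \<le> (LINT t:{0..}|lebesgue. g t) / h"
  unfolding sum_cell_mean using h_pos g_int g_nonneg
  by (intro divide_right_mono set_lebesgue_integral_mono_set) auto

lemma summable_cell_mean: "summable (\<lambda>j. cell_mean h g (int j))"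
  by (rule summableI_nonneg_bounded[OF cell_mean_nonneg sum_cell_mean_le])

text \<open>Applied to the moment density \<open>w\<close>: the factor \<open>1 / h\<close> later
  cancels against the \<open>h\<close> in front of the history sum, which leaves a constant
  independent of \<open>h\<close>.\<close>

lemma suminf_cell_mean_le: "(\<Sum>j. cell_mean h g (int j)) \<le> (LINT t:{0..}|lebesgue. g t) / h"
  by (rule suminf_le_const[OF summable_cell_mean sum_cell_mean_le])

end

lemma cell_mean_mono:
  assumes "0 < h" and "set_integrable lebesgue {of_int n * h..(of_int n + 1) * h} f"
    and "set_integrable lebesgue {of_int n * h..(of_int n + 1) * h} g"
    and "\<And>t. t \<in> {of_int n * h..(of_int n + 1) * h} \<Longrightarrow> f t \<le> g t"
  shows "cell_mean h f n \<le> cell_mean h g n"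
  unfolding cell_mean_def using assms by (intro mult_left_mono set_integral_mono) auto

lemma cell_mean_cmult: "cell_mean h (\<lambda>t. c * g t) n = c * cell_mean h g n"
  by (simp add: cell_mean_def)

text \<open>The induction runs on the whole right-hand side of the recursive bound instead of on
  \<open>u n\<close>: this quantity grows by a factor of at most \<open>1 + b\<close> per
  step.\<close>

lemma discrete_gronwall:
  fixes u :: "nat \<Rightarrow> real"
  assumes "0 \<le> a" "0 \<le> b" and step: "\<And>n. n \<le> N \<Longrightarrow> u n \<le> a + b * (\<Sum>k<n. u k)" and "n \<le> N"
  shows "u n \<le> a * (1 + b) ^ n"
proof -
  have sum: "a + b * (\<Sum>k<n. u k) \<le> a * (1 + b) ^ n" if "n \<le> N" for n
    using that
  proof (induction n)
    case (Suc n)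
    have "a + b * (\<Sum>k<Suc n. u k) = (a + b * (\<Sum>k<n. u k)) + b * u n"
      by (simp add: algebra_simps)
    also have "\<dots> \<le> (a + b * (\<Sum>k<n. u k)) + b * (a + b * (\<Sum>k<n. u k))"
      using step[of n] Suc.prems \<open>0 \<le> b\<close> by (intro add_left_mono mult_left_mono) auto
    also have "\<dots> = (1 + b) * (a + b * (\<Sum>k<n. u k))" by (simp add: algebra_simps)
    also have "\<dots> \<le> (1 + b) * (a * (1 + b) ^ n)"
      using Suc \<open>0 \<le> b\<close> by (intro mult_left_mono) auto
    finally show ?case by (simp add: algebra_simps)
  qed simp
  show ?thesis using step[OF \<open>n \<le> N\<close>] sum[OF \<open>n \<le> N\<close>] by linarith
qed

section \<open>Bounds on the data: past values, source term, kernel mass\<close>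

lemma abs_cell_mean_past_le:
  assumes "0 < h" and lip: "L-lipschitz_on {..<0} zp" and "n < 0"
  shows "\<bar>cell_mean h zp n\<bar> \<le> (\<bar>zp (-1)\<bar> + L) * (1 + of_int (- n) * h)"
proof -
  have L: "0 \<le> L" using lip by (rule lipschitz_on_nonneg)
  have neg: "(of_int n + 1) * h \<le> 0"
    using assms by (intro mult_nonpos_nonneg) linarith+
  \<comment> \<open>Linear growth comes from comparison with the reference point -1:
    \<open>\<bar>t + 1\<bar>\<close> is at most 1 plus the distance of \<open>t\<close> from 0,
    which is largest at the left end of the cell.\<close>
  have bound: "\<bar>zp t\<bar> \<le> (\<bar>zp (-1)\<bar> + L) * (1 + of_int (- n) * h)"
    if "t \<noteq> 0" "t \<in> {of_int n * h..(of_int n + 1) * h}" for t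
  proof -
    have "t < 0" and t: "- t \<le> of_int (- n) * h" using that neg by auto
    then have "\<bar>zp t - zp (-1)\<bar> \<le> L * \<bar>t + 1\<bar>"
      using lipschitz_onD[OF lip, of t "-1"] by (simp add: dist_real_def)
    also have "\<dots> \<le> L * (1 + of_int (- n) * h)"
      using L t \<open>t < 0\<close> by (intro mult_left_mono) linarith+
    finally have "\<bar>zp t\<bar> \<le> \<bar>zp (-1)\<bar> * 1 + L * (1 + of_int (- n) * h)" by linarith
    also have "\<dots> \<le> \<bar>zp (-1)\<bar> * (1 + of_int (- n) * h) + L * (1 + of_int (- n) * h)"
      using t \<open>t < 0\<close> by (intro add_right_mono mult_left_mono) linarith+
    finally show ?thesis by (simp add: distrib_right)
  qed
  \<comment> \<open>For \<open>n = -1\<close> the cell reaches 0, where the Lipschitz condition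
    gives no information.\<close>
  have "AE t in lebesgue. t \<noteq> (0::real)"
    by (rule AE_completion) (rule AE_lborel_singleton)
  then have "AE t in lebesgue. t \<in> {of_int n * h..(of_int n + 1) * h} \<longrightarrow>
      \<bar>zp t\<bar> \<le> (\<bar>zp (-1)\<bar> + L) * (1 + of_int (- n) * h)"
    by eventually_elim (use bound in blast)
  moreover have "0 \<le> of_int (- n) * h" using assms by (intro mult_nonneg_nonneg) auto
  ultimately show ?thesis
    using assms L by (intro abs_cell_mean_le) auto
qed

lemma L_infinity_cell_mean_bounded:
  assumes "f \<in> L_infinity_on {0..}"
  obtains K where "0 \<le> K" "\<And>h n. 0 < h \<Longrightarrow> \<bar>cell_mean h f (int n)\<bar> \<le> K"
proof -
  obtain K where "AE t in lebesgue_on {0..}. \<bar>f t\<bar> \<le> K"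
    using assms by (auto simp: L_infinity_on_def)
  then have K: "AE t in lebesgue. t \<in> {0..} \<longrightarrow> \<bar>f t\<bar> \<le> K"
    by (subst (asm) AE_restrict_space_iff) auto
  show ?thesis
  \<comment> \<open>The maximum supplies the sign of the bound directly.\<close>
  proof (rule that[of "max 0 K"])
    fix h :: real and n :: nat assume "0 < h"
    from K have "AE t in lebesgue. t \<in> {of_int (int n) * h..(of_int (int n) + 1) * h}
        \<longrightarrow> \<bar>f t\<bar> \<le> max 0 K"
      by eventually_elim (use cell_subset[OF \<open>0 < h\<close>, of n] in fastforce)
    then show "\<bar>cell_mean h f (int n)\<bar> \<le> max 0 K"
      using \<open>0 < h\<close> by (intro abs_cell_mean_le) auto
  qed simp
qed

text \<open>On the compact interval \<open>{T..T + 1}\<close> the continuous positive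
  \<open>\<rho>\<close> attains a positive minimum, so some mass lies beyond \<open>T\<close>.
  Strictness is what later permits division by \<open>1 - q\<close>.\<close>

lemma mass_Icc_less:
  fixes \<rho> :: "real \<Rightarrow> real"
  assumes cont: "continuous_on {0..} \<rho>" and pos: "\<forall>a>0. 0 < \<rho> a" and nonneg: "\<forall>a\<ge>0. 0 \<le> \<rho> a"
    and int: "set_integrable lebesgue {0..} \<rho>" and "0 < T"
  shows "(LINT a:{0..T}|lebesgue. \<rho> a) < (LINT a:{0..}|lebesgue. \<rho> a)"
proof -
  have "continuous_on {T..T + 1} \<rho>"
    using \<open>0 < T\<close> by (intro continuous_on_subset[OF cont]) auto
  then obtain c where c: "c \<in> {T..T + 1}" "\<And>a. a \<in> {T..T + 1} \<Longrightarrow> \<rho> c \<le> \<rho> a"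
    using continuous_attains_inf[of "{T..T + 1}" \<rho>] by auto
  have sub: "set_integrable lebesgue {a..b} \<rho>" if "0 \<le> a" for a b
    using that by (intro set_integrable_subset[OF int]) auto
  have "(LINT a:{T..T + 1}|lebesgue. \<rho> c) \<le> (LINT a:{T..T + 1}|lebesgue. \<rho> a)"
    using c \<open>0 < T\<close>
    by (intro set_integral_mono sub set_integrable_const_Icc) auto
  moreover have "(LINT a:{T..T + 1}|lebesgue. \<rho> c) = \<rho> c"
    by (simp add: set_lebesgue_integral_def)
  moreover have "0 < \<rho> c" using c(1) pos \<open>0 < T\<close> by auto
  moreover have "(LINT a:{0..T + 1}|lebesgue. \<rho> a)
      = (LINT a:{0..T}|lebesgue. \<rho> a) + (LINT a:{T..T + 1}|lebesgue. \<rho> a)"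
    using \<open>0 < T\<close> by (intro set_lebesgue_integral_combine sub) auto
  moreover have "(LINT a:{0..T + 1}|lebesgue. \<rho> a) \<le> (LINT a:{0..}|lebesgue. \<rho> a)"
    using nonneg by (intro set_lebesgue_integral_mono_set int) auto
  ultimately show ?thesis by linarith
qed

section \<open>The bound uniform in the step size\<close>

theorem theorem2:
  fixes f zp \<rho> :: "real \<Rightarrow> real" and \<zeta> T :: real
  assumes f_bounded: "f \<in> L_infinity_on {0..}"
    and zp_lipschitz: "\<exists>L. L-lipschitz_on {..<0} zp"
    and rho_lipschitz: "\<exists>L. L-lipschitz_on {0..} \<rho>"
    and rho_nonneg: "\<forall>a\<ge>0. \<rho> a \<ge> 0"
    and rho_pos: "\<forall>a>0. \<rho> a > 0"
    and rho_integrable: "set_integrable lebesgue {0..} \<rho>"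
    and rho_mass: "(LINT a:{0..}|lebesgue. \<rho> a) = 1"
    and rho_moment: "set_integrable lebesgue {0..} (\<lambda>a. (1 + a)\<^sup>2 * \<rho> a)"
    and rho_decreasing: "AE a in lebesgue_on {0<..}. deriv \<rho> a \<le> 0"
    and zeta_pos: "\<zeta> > 0"
    and rho_log_deriv: "AE a in lebesgue_on {0<..}. - deriv \<rho> a / \<rho> a \<le> \<zeta>"
    and T_pos: "T > 0"
  shows "\<exists>C>0. \<forall>h>0. \<forall>N::nat. real N = T / h \<longrightarrow>
           (\<forall>Z. discrete_solution h N \<rho> f zp Z \<longrightarrow> (\<forall>n\<in>{0..int N}. \<bar>Z n\<bar> \<le> C))"
proof -
  obtain Lz where Lz: "Lz-lipschitz_on {..<0} zp" using zp_lipschitz by blast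
  obtain L where L: "L-lipschitz_on {0..} \<rho>" using rho_lipschitz by blast
  obtain K where K: "0 \<le> K" "\<And>h n. 0 < h \<Longrightarrow> \<bar>cell_mean h f (int n)\<bar> \<le> K"
    using L_infinity_cell_mean_bounded[OF f_bounded] by blast
  define A where "A = \<bar>zp (-1)\<bar> + Lz"
  define w where "w a = (1 + a)\<^sup>2 * \<rho> a" for a
  define I where "I = (LINT a:{0..}|lebesgue. w a)"
  \<comment> \<open>A bound for \<open>\<rho>\<close> on \<open>{0..2 * T}\<close>: the cells with
    \<open>j \<le> N\<close> end at or before \<open>T + h\<close>, and
    \<open>h \<le> T\<close>.\<close>
  define M where "M = \<rho> 0 + L * (2 * T)"
  define q where "q = (LINT a:{0..T}|lebesgue. \<rho> a)"
  have A: "0 \<le> A" using lipschitz_on_nonneg[OF Lz] by (simp add: A_def)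
  have w_nonneg: "0 \<le> w a" if "0 \<le> a" for a using rho_nonneg that by (simp add: w_def)
  have w_int: "set_integrable lebesgue {0..} w" using rho_moment by (simp add: w_def[abs_def])
  have I: "0 \<le> I" unfolding I_def set_lebesgue_integral_def
    by (intro Bochner_Integration.integral_nonneg) (auto simp: w_nonneg indicator_def)
  have M: "0 \<le> M" using lipschitz_on_nonneg[OF L] rho_nonneg T_pos by (simp add: M_def)
  have rho_le: "\<rho> a \<le> M" if "a \<in> {0..2 * T}" for a
  proof -
    have "\<rho> a - \<rho> 0 \<le> L * a"
      using lipschitz_onD[OF L, of a 0] that by (simp add: dist_real_def)
    also have "\<dots> \<le> L * (2 * T)"
      using that lipschitz_on_nonneg[OF L] by (intro mult_left_mono) auto
    finally show ?thesis by (simp add: M_def)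
  qed
  have q: "q < 1"
    using mass_Icc_less[OF lipschitz_on_continuous_on[OF L] rho_pos rho_nonneg rho_integrable T_pos]
    by (simp add: q_def rho_mass)
  \<comment> \<open>The Gronwall constants, both free of \<open>h\<close>; the division by
    \<open>1 - q\<close> comes from absorbing the implicit term.\<close>
  define a where "a = (K + A * I) / (1 - q)"
  define b where "b = M / (1 - q)"
  have a: "0 \<le> a" using K A I q by (simp add: a_def)
  have b: "0 \<le> b" using M q by (simp add: b_def)
  have main: "\<bar>Z (int n)\<bar> \<le> a * exp (b * T)"
    if h: "0 < h" and N: "real N = T / h" and sol: "discrete_solution h N \<rho> f zp Z" and n: "n \<le> N"
    for h :: real and N n :: nat and Z
  proof -
    define u where "u k = \<bar>Z (int k)\<bar>" for k
    define R where "R j = cell_mean h \<rho> (int j)" for j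
    have Nh: "real N * h = T" using N h by simp
    \<comment> \<open>\<open>N = 0\<close> would force \<open>T / h = 0\<close>. Hence
      \<open>h = T / N \<le> T\<close>, so the first cell lies in \<open>{0..T}\<close> and
      \<open>R 0\<close> is controlled by \<open>q\<close>.\<close>
    have "0 < N" using N h T_pos by (cases N) auto
    then have hT: "h \<le> T" using Nh h mult_right_mono[of 1 "real N" h] by simp
    have R_nonneg: "0 \<le> R j" for j
      unfolding R_def using rho_nonneg by (intro cell_mean_nonneg h rho_integrable) auto
    have R0: "R 0 \<le> q / h"
    proof -
      have "(LINT t:{0..h}|lebesgue. \<rho> t) \<le> q"
        unfolding q_def using hT rho_nonneg
        by (intro set_lebesgue_integral_mono_set set_integrable_subset[OF rho_integrable]) auto
      then show ?thesis using h by (simp add: R_def cell_mean_def divide_right_mono)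
    qed
    have R_le: "R j \<le> M" if "j \<le> N" for j
    proof -
      have "real j * h \<le> real N * h" using that h by (intro mult_right_mono) auto
      then have "(real j + 1) * h \<le> 2 * T"
        using Nh hT by (simp add: distrib_right)
      moreover have "0 \<le> real j * h" using h by simp
      ultimately have "\<bar>\<rho> t\<bar> \<le> M" if "t \<in> {real j * h..(real j + 1) * h}" for t
        using that rho_le[of t] rho_nonneg by auto
      then have "\<bar>cell_mean h \<rho> (int j)\<bar> \<le> M"
        using h M by (intro abs_cell_mean_le) auto
      then show ?thesis by (simp add: R_def)
    qed
    \<comment> \<open>The left end of the cell is at most \<open>t\<close>, and
      \<open>1 + t \<le> (1 + t)\<^sup>2\<close>: the moment density dominates the kernel times the
      linear growth of the past.\<close>
    have R_w: "(1 + real j * h) * R j \<le> cell_mean h w (int j)" for j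
      unfolding R_def cell_mean_cmult[symmetric]
    proof (rule cell_mean_mono[OF h])
      note cell = cell_subset[OF h, of j]
      show "set_integrable lebesgue {of_int (int j) * h..(of_int (int j) + 1) * h}
          (\<lambda>t. (1 + real j * h) * \<rho> t)"
        by (intro set_integrable_mult_right set_integrable_subset[OF rho_integrable _ cell]) auto
      show "set_integrable lebesgue {of_int (int j) * h..(of_int (int j) + 1) * h} w"
        by (intro set_integrable_subset[OF w_int _ cell]) auto
      fix t assume t: "t \<in> {of_int (int j) * h..(of_int (int j) + 1) * h}"
      then have "0 \<le> t" using cell by auto
      then have "1 + t \<le> (1 + t)\<^sup>2" by (simp add: power2_eq_square)
      then have "1 + real j * h \<le> (1 + t)\<^sup>2" using t by simp
      then show "(1 + real j * h) * \<rho> t \<le> w t"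
        unfolding w_def using rho_nonneg \<open>0 \<le> t\<close> by (intro mult_right_mono) auto
    qed
    have step: "u m \<le> a + (b * h) * (\<Sum>k<m. u k)" if m: "m \<le> N" for m
    proof -
      \<comment> \<open>\<open>g\<close> majorises the terms \<open>j \<le> m\<close>, with the
        implicit one kept apart, and vanishes afterwards; \<open>d\<close> majorises the terms that
        reach into the past. In \<open>g + d\<close> the other summand is zero or nonnegative
        slack.\<close>
      define g where "g j = (if j = 0 then q / h * u m else if j \<le> m then M * u (m - j) else 0)" for j
      define d where "d j = A * cell_mean h w (int j)" for j
      have d_nonneg: "0 \<le> d j" for j
        unfolding d_def using A w_nonneg by (intro mult_nonneg_nonneg cell_mean_nonneg h w_int) auto
      have bound: "norm (Z (int m - int j) * R j) \<le> g j + d j" for j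
      proof (cases "j \<le> m")
        case True
        then have "norm (Z (int m - int j) * R j) = R j * u (m - j)"
          using R_nonneg[of j] by (simp add: abs_mult u_def of_nat_diff)
        also have "\<dots> \<le> g j"
          using True R0 R_le[of j] m
          by (auto simp: g_def u_def simp del: times_divide_eq_left intro!: mult_right_mono)
        finally show ?thesis using d_nonneg[of j] by linarith
      next
        case False
        then have neg: "int m - int j < 0" by simp
        then have "\<bar>Z (int m - int j)\<bar> \<le> A * (1 + of_int (- (int m - int j)) * h)"
          using sol abs_cell_mean_past_le[OF h Lz neg] by (simp add: discrete_solution_def A_def)
        \<comment> \<open>The index distance into the past is \<open>j - m\<close>; enlarging it to
          \<open>j\<close> matches the weight in \<open>R_w\<close>.\<close>
        also have "\<dots> \<le> A * (1 + real j * h)"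
          using A h by (intro mult_left_mono add_left_mono mult_right_mono) auto
        finally have "\<bar>Z (int m - int j)\<bar> * R j \<le> A * ((1 + real j * h) * R j)"
          using R_nonneg[of j] by (metis mult.assoc mult_right_mono)
        also have "\<dots> \<le> d j" unfolding d_def by (intro mult_left_mono R_w A)
        finally show ?thesis using False R_nonneg[of j] by (simp add: g_def abs_mult)
      qed
      have g_sums: "g sums (\<Sum>j\<le>m. g j)"
        by (rule sums_finite) (auto simp: g_def)
      have "(\<Sum>j\<le>m. g j) = q / h * u m + (\<Sum>j<m. M * u (m - Suc j))"
        by (simp add: sum.atMost_shift g_def)
      also have "(\<Sum>j<m. M * u (m - Suc j)) = M * (\<Sum>k<m. u k)"
        by (simp add: sum.nat_diff_reindex[of "\<lambda>k. M * u k"] sum_distrib_left)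
      finally have g_suminf: "suminf g = q / h * u m + M * (\<Sum>k<m. u k)"
        using sums_unique[OF g_sums] by simp
      have w_summable: "summable (\<lambda>j. cell_mean h w (int j))"
        using w_nonneg by (intro summable_cell_mean h w_int) auto
      have "suminf d = A * (\<Sum>j. cell_mean h w (int j))"
        unfolding d_def[abs_def] by (rule suminf_mult[OF w_summable])
      also have "\<dots> \<le> A * (I / h)"
        unfolding I_def using w_nonneg by (intro mult_left_mono A suminf_cell_mean_le h w_int) auto
      finally have d_suminf: "suminf d \<le> A * (I / h)" .
      have d_summable: "summable d"
        unfolding d_def[abs_def] by (rule summable_mult[OF w_summable])
      \<comment> \<open>Convergence of the history series comes with the comparison, since the
        majorant is summable.\<close>
      have "\<bar>\<Sum>j. Z (int m - int j) * R j\<bar> \<le> (\<Sum>j. g j + d j)"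
        using norm_suminf_le[OF bound summable_add[OF sums_summable[OF g_sums] d_summable]] by simp
      also have "\<dots> \<le> q / h * u m + M * (\<Sum>k<m. u k) + A * (I / h)"
        using suminf_add[OF sums_summable[OF g_sums] d_summable] g_suminf d_suminf by simp
      \<comment> \<open>The factor \<open>h\<close> cancels in \<open>q / h\<close> and
        \<open>I / h\<close> and stays only with \<open>M\<close>, where it becomes the Gronwall
        coefficient.\<close>
      finally have "h * \<bar>\<Sum>j. Z (int m - int j) * R j\<bar>
          \<le> h * (q / h * u m + M * (\<Sum>k<m. u k) + A * (I / h))"
        using h by (intro mult_left_mono) auto
      also have "\<dots> = q * u m + M * h * (\<Sum>k<m. u k) + A * I"
        using h by (simp add: field_simps)
      finally have hist: "\<bar>h * (\<Sum>j. Z (int m - int j) * R j)\<bar>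
          \<le> q * u m + M * h * (\<Sum>k<m. u k) + A * I"
        using h by (simp add: abs_mult)
      have "Z (int m) - h * (\<Sum>j. Z (int m - int j) * R j) = cell_mean h f (int m)"
        using sol m by (simp add: discrete_solution_def R_def)
      then have "u m \<le> K + (q * u m + M * h * (\<Sum>k<m. u k) + A * I)"
        using hist K(2)[OF h, of m] unfolding u_def by linarith
      \<comment> \<open>The implicit term moves to the left; \<open>q < 1\<close> keeps its
        coefficient positive for every admissible \<open>h\<close>.\<close>
      then have "(1 - q) * u m \<le> (K + A * I) + M * h * (\<Sum>k<m. u k)"
        by (simp add: algebra_simps)
      then have "u m \<le> ((K + A * I) + M * h * (\<Sum>k<m. u k)) / (1 - q)"
        using q by (simp add: pos_le_divide_eq mult.commute)
      then show ?thesis by (simp add: a_def b_def add_divide_distrib)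
    qed
    have "u n \<le> a * (1 + b * h) ^ n"
      using a b h n by (intro discrete_gronwall[where N = N] step) auto
    \<comment> \<open>By \<open>1 + x \<le> exp x\<close> the power turns into an exponential of
      \<open>b * (n * h)\<close>, and \<open>n * h \<le> N * h = T\<close> removes the dependence on
      \<open>h\<close>.\<close>
    also have "\<dots> \<le> a * exp (b * h) ^ n"
      using a b h by (intro mult_left_mono power_mono) auto
    also have "\<dots> = a * exp (b * (real n * h))"
      by (simp add: exp_of_nat_mult[symmetric] algebra_simps)
    also have "\<dots> \<le> a * exp (b * T)"
      unfolding Nh[symmetric] using a b n h
      by (intro mult_left_mono exp_le_cancel_iff[THEN iffD2] mult_right_mono) auto
    finally show ?thesis by (simp add: u_def)
  qed
  \<comment> \<open>The constant must be strictly positive, while \<open>a\<close> may be 0 for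
    vanishing data; hence the added 1.\<close>
  have "0 \<le> a * exp (b * T)" using a by simp
  then have "0 < a * exp (b * T) + 1" by linarith
  moreover have "\<bar>Z n\<bar> \<le> a * exp (b * T) + 1"
    if "0 < h" "real N = T / h" "discrete_solution h N \<rho> f zp Z" "n \<in> {0..int N}" for h N Z n
    using main[OF that(1-3), of "nat n"] that(4) by (simp add: nat_le_iff)
  ultimately show ?thesis by blast
qed

end
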